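(* The solution $\bar{\mathbf y}$ returned by the pooling-adjacent-violators (PAV) algorithm described in the context satisfies $\mathbf 0\in\partial\Gamma(\bar{\mathbf y})$, where $$\Gamma(\mathbf y)=\sum_{i=1}^N\Big(-c_iU(y_{[i]})+\frac\sigma2(y_{[i]}-w_i)^2\Big),\qquad\mathbf y\in\mathbb R^N .$$
   Context: Utility. Fix $B\in\mathbb R$ and a function $U:\mathbb R\to\mathbb R$ with $U(B)=0$ such that: (1) $U$ is strictly increasing and continuous on $\mathbb R$; (2) $U$ is three times continuously differentiable on $(-\infty,B)$ and on $(B,\infty)$; (3) $U''>0$ on $(-\infty,B)$ and $U''<0$ on $(B,\infty)$; (4) $U'''>0$ on $(-\infty,B)$; (5) $U'(B^-)=\infty$ if and only if $U'(B^+)=\infty$, where $U'(B^\pm)=\lim_{y\to B^\pm}U'(y)$. Data. $\sigma>0$, $w_1\le w_2\le\dots\le w_N$ are real, and $a_i>0$, $b_i>0$ for $i=1,\dots,N$. $y_{[i]}$ is the $i$-th smallest entry of $\mathbf y$. The weight $c_i$ in an expression $c_iU(t)$ equals $a_i$ if $t\le B$ and $b_i$ if $t>B$. Put $f_i(y)=-c_iU(y)+\frac\sigma2(y-w_i)^2$ for $y\in\mathbb R$. PAV algorithm. For integers $m\le n$, $[m,n]$ denotes the index set $\{m,m+1,\dots,n\}$, and $g_{[m,n]}(y)=\sum_{i=m}^nf_i(y)$, $y\in\mathbb R$. Start with $J=\{[1,1],[2,2],\dots,[N,N]\}$ and, for each $i$, let $V_{[i,i]}$ be a (global) minimizer of $f_i$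 on $\mathbb R$. While there are consecutive blocks $[m,n],[n+1,p]\in J$ with $V_{[m,n]}>V_{[n+1,p]}$, replace these two blocks in $J$ by $[m,p]$ and let $V_{[m,p]}$ be a (global) minimizer of $g_{[m,p]}$ on $\mathbb R$. When no such pair remains, set $\bar y_i=V_{[m,n]}$ for all $i\in[m,n]$ and all blocks $[m,n]\in J$, and return $\bar{\mathbf y}=(\bar y_1,\dots,\bar y_N)$. $\partial\Gamma(\mathbf y)$ is the Clarke generalized gradient, defined at points near which $\Gamma$ is locally Lipschitz: $\partial\Gamma(\mathbf y)=\mathrm{conv}\{\lim_{i\to\infty}\nabla\Gamma(\mathbf y^i):\mathbf y^i\to\mathbf y,\ \Gamma\text{ differentiable at }\mathbf y^i\}$; the inclusion in the claim is understood to include that $\Gamma$ is locally Lipschitz near $\bar{\mathbf y}$. *)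

theory Defs
  imports "HOL-Analysis.Analysis"
begin

text \<open>\<open>Ck_on k f S\<close> is meant for open sets \<open>S\<close>: \<open>f\<close> is \<open>k\<close> times continuously differentiable on \<open>S\<close>.\<close>

definition Ck_on :: "nat \<Rightarrow> (real \<Rightarrow> real) \<Rightarrow> real set \<Rightarrow> bool" where
  "Ck_on k f S \<longleftrightarrow>
     (\<forall>j<k. \<forall>x\<in>S. (deriv ^^ j) f differentiable (at x)) \<and> continuous_on S ((deriv ^^ k) f)"

definition weight :: "real \<Rightarrow> (nat \<Rightarrow> real) \<Rightarrow> (nat \<Rightarrow> real) \<Rightarrow> nat \<Rightarrow> real \<Rightarrow> real" where
  "weight B a b i t = (if t \<le> B then a i else b i)"

definition cost :: "(real \<Rightarrow> real) \<Rightarrow> real \<Rightarrow> real \<Rightarrow> (nat \<Rightarrow> real) \<Rightarrow> (nat \<Rightarrow> real) \<Rightarrow> (nat \<Rightarrow> real)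
    \<Rightarrow> nat \<Rightarrow> real \<Rightarrow> real" where
  "cost U B \<sigma> w a b i y = - (weight B a b i y * U y) + \<sigma> / 2 * (y - w i)\<^sup>2"

text \<open>
  The PAV algorithm for cost functions \<open>f 1, \<dots>, f N\<close>. A block \<open>[m,n]\<close> is the pair
  \<open>(m, n)\<close>; a state is the current set \<open>J\<close> of blocks with the assignment \<open>V\<close>, which only
  matters on blocks. Both the choice of minimizers and the choice of the
  violating pair are nondeterministic, so \<open>pav_reachable\<close> covers every run.
\<close>

definition block_cost :: "(nat \<Rightarrow> real \<Rightarrow> real) \<Rightarrow> nat \<Rightarrow> nat \<Rightarrow> real \<Rightarrow> real" where
  "block_cost f m n y = (\<Sum>i=m..n. f i y)"

definition global_minimizer :: "(real \<Rightarrow> real) \<Rightarrow> real \<Rightarrow> bool" where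
  "global_minimizer h v \<longleftrightarrow> is_arg_min h (\<lambda>_. True) v"

inductive pav_reachable ::
  "(nat \<Rightarrow> real \<Rightarrow> real) \<Rightarrow> nat \<Rightarrow> (nat \<times> nat) set \<Rightarrow> (nat \<times> nat \<Rightarrow> real) \<Rightarrow> bool"
  for f :: "nat \<Rightarrow> real \<Rightarrow> real" and N :: nat where
  init: "(\<forall>i\<in>{1..N}. global_minimizer (f i) (V (i, i)))
    \<Longrightarrow> pav_reachable f N ((\<lambda>i. (i, i)) ` {1..N}) V"
| merge: "\<lbrakk>pav_reachable f N J V; (m, n) \<in> J; (n + 1, p) \<in> J; V (m, n) > V (n + 1, p);
     global_minimizer (block_cost f m p) v\<rbrakk>
    \<Longrightarrow> pav_reachable f N (insert (m, p) (J - {(m, n), (n + 1, p)})) (V((m, p) := v))"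

definition pav_returns :: "(nat \<Rightarrow> real \<Rightarrow> real) \<Rightarrow> nat \<Rightarrow> (nat \<Rightarrow> real) \<Rightarrow> bool" where
  "pav_returns f N ybar \<longleftrightarrow> (\<exists>J V. pav_reachable f N J V \<and>
     \<not> (\<exists>m n p. (m, n) \<in> J \<and> (n + 1, p) \<in> J \<and> V (m, n) > V (n + 1, p)) \<and>
     (\<forall>m n. (m, n) \<in> J \<longrightarrow> (\<forall>i\<in>{m..n}. ybar i = V (m, n))))"

text \<open>The \<open>i\<close>-th smallest entry of \<open>y\<close>, counted with multiplicity, for \<open>i\<close> from \<open>1\<close> to \<open>CARD('n)\<close>.\<close>

definition order_stat :: "real ^ 'n \<Rightarrow> nat \<Rightarrow> real" where
  "order_stat y i = sorted_list_of_multiset (image_mset (\<lambda>j. y $ j) (mset_set UNIV)) ! (i - 1)"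

definition sorted_cost :: "(nat \<Rightarrow> real \<Rightarrow> real) \<Rightarrow> real ^ 'n \<Rightarrow> real" where
  "sorted_cost f y = (\<Sum>i=1..CARD('n). f i (order_stat y i))"

definition locally_lipschitz_at :: "('a::euclidean_space \<Rightarrow> real) \<Rightarrow> 'a \<Rightarrow> bool" where
  "locally_lipschitz_at h x \<longleftrightarrow> (\<exists>e>0. \<exists>L. L-lipschitz_on (ball x e) h)"

text \<open>To be used only where \<open>locally_lipschitz_at\<close> holds.\<close>

definition clarke_gradient :: "('a::euclidean_space \<Rightarrow> real) \<Rightarrow> 'a \<Rightarrow> 'a set" where
  "clarke_gradient h x = convex hull
     {v. \<exists>X G. X \<longlonglongrightarrow> x \<and> (\<forall>k::nat. GDERIV h (X k) :> G k) \<and> G \<longlonglongrightarrow> v}"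

end

theory Submission
  imports Defs
begin

text \<open>
  The PAV output \<open>ybar\<close> is nondecreasing in the index, because the algorithm stops only when no two
  adjacent blocks are out of order, and it is constant on blocks, each block value minimizing the
  total cost of its block. So \<open>ybar i\<close> is the \<open>i\<close>-th order statistic of \<open>ybar\<close>, in whatever order the
  entries are listed. Ties between entries make \<open>\<Gamma>\<close> nonsmooth even where all the \<open>f i\<close> are smooth.

  Call a set of indices on which \<open>ybar\<close> takes the same value a level class; it is a union of blocks.
  Spreading the tied entries of \<open>ybar\<close> slightly apart, in an arbitrary order within each class, gives
  points near which \<open>\<Gamma>\<close> is a separable sum of the \<open>f i\<close>, so its gradient there consists of the
  derivatives of the \<open>f i\<close>. If all entries are pushed down, these gradients converge to the vector of
  left slopes \<open>l i\<close> of \<open>f i\<close> at \<open>ybar i\<close>, and if all are pushed up, to the vector of right slopes \<open>r i\<close>,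
  each with the indices permuted within the classes as prescribed (\<open>slopes_in_gradient_limits\<close>).
  Averaging over all these permutations replaces every slope by its mean over the class
  (\<open>class_mean_in_convex_hull\<close>).

  First-order optimality of a block minimizer says that the left slopes over the block have sum at
  most \<open>0\<close> and the right slopes sum at least \<open>0\<close>; adding up blocks, the same holds for classes.
  Away from \<open>B\<close> the left and right slopes agree, so these means vanish. At most one class has the
  value \<open>B\<close>, and on it the two means are at most and at least \<open>0\<close>, respectively, so a convex
  combination of the two averaged vectors is \<open>0\<close> (\<open>zero_in_clarke_gradient_sorted_cost\<close>).

  What remains is that the slopes are finite where they are needed. The only doubtful point is \<open>B\<close>.
  If \<open>U'\<close> is infinite there on the right, every block cost still decreases to the right of \<open>B\<close>, so
  \<open>B\<close> is no block value (\<open>kink_not_minimizer\<close>). Otherwise \<open>U'\<close> is finite on both sides by the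
  assumption relating the two one-sided limits (\<open>finite_slopes\<close>).
\<close>

section \<open>Real functions with one-sided slopes\<close>

text \<open>
  The slopes \<open>l\<close> and \<open>r\<close> are limits of derivatives at nearby points, not one-sided difference quotients:
  the Clarke gradient is built from such limits, and their finiteness bounds the derivative near \<open>v\<close>,
  which makes \<open>f\<close> Lipschitz there.
\<close>

definition one_sided_slopes :: "(real \<Rightarrow> real) \<Rightarrow> real \<Rightarrow> real \<Rightarrow> real \<Rightarrow> bool" where
  "one_sided_slopes f v l r \<longleftrightarrow> isCont f v \<and> (\<forall>\<^sub>F x in at v. f differentiable (at x)) \<and>
     (deriv f \<longlongrightarrow> l) (at_left v) \<and> (deriv f \<longlongrightarrow> r) (at_right v)"

lemma one_sided_slopesI:
  assumes "isCont f v"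
    and D: "\<forall>\<^sub>F x in at v. (f has_real_derivative D x) (at x)"
    and "(D \<longlongrightarrow> l) (at_left v)" and "(D \<longlongrightarrow> r) (at_right v)"
  shows "one_sided_slopes f v l r"
proof -
  have eq: "\<forall>\<^sub>F x in at v. D x = deriv f x"
    using D by eventually_elim (simp add: DERIV_imp_deriv)
  have "\<forall>\<^sub>F x in at v. f differentiable (at x)"
    using D by eventually_elim (auto simp: real_differentiable_def)
  moreover have "(deriv f \<longlongrightarrow> l) (at_left v)" "(deriv f \<longlongrightarrow> r) (at_right v)"
    using eq assms(3,4) by (auto simp: eventually_at_split intro: Lim_transform_eventually)
  ultimately show ?thesis using assms(1) by (simp add: one_sided_slopes_def)
qed

lemma one_sided_slopes_has_derivative:
  assumes "one_sided_slopes f v l r"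
  shows "\<forall>\<^sub>F x in at v. (f has_real_derivative deriv f x) (at x)"
  using assms unfolding one_sided_slopes_def
  by (auto elim!: eventually_mono simp: DERIV_deriv_iff_real_differentiable)

lemma one_sided_slopes_sum:
  assumes "finite A" "\<And>i. i \<in> A \<Longrightarrow> one_sided_slopes (f i) v (l i) (r i)"
  shows "one_sided_slopes (\<lambda>x. \<Sum>i\<in>A. f i x) v (\<Sum>i\<in>A. l i) (\<Sum>i\<in>A. r i)"
proof (rule one_sided_slopesI[where D = "\<lambda>x. \<Sum>i\<in>A. deriv (f i) x"])
  show "isCont (\<lambda>x. \<Sum>i\<in>A. f i x) v"
    using assms by (auto intro!: continuous_intros simp: one_sided_slopes_def)
  have "\<forall>\<^sub>F x in at v. \<forall>i\<in>A. (f i has_real_derivative deriv (f i) x) (at x)"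
    using assms by (auto intro!: eventually_ball_finite one_sided_slopes_has_derivative)
  then show "\<forall>\<^sub>F x in at v. ((\<lambda>x. \<Sum>i\<in>A. f i x) has_real_derivative (\<Sum>i\<in>A. deriv (f i) x)) (at x)"
    by eventually_elim (auto intro!: DERIV_sum)
qed (use assms in \<open>auto intro!: tendsto_sum simp: one_sided_slopes_def\<close>)

lemma one_sided_slopes_imp_locally_lipschitz:
  assumes "one_sided_slopes f v l r"
  shows "locally_lipschitz_at f v"
proof -
  define K where "K = \<bar>l\<bar> + \<bar>r\<bar> + 1"
  have "\<forall>\<^sub>F x in at_left v. norm (deriv f x) < K"
    using assms by (intro order_tendstoD(2)[OF tendsto_norm[of _ l]])
      (auto simp: one_sided_slopes_def K_def)
  moreover have "\<forall>\<^sub>F x in at_right v. norm (deriv f x) < K"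
    using assms by (intro order_tendstoD(2)[OF tendsto_norm[of _ r]])
      (auto simp: one_sided_slopes_def K_def)
  ultimately have "\<forall>\<^sub>F x in at v. norm (deriv f x) < K"
    by (simp add: eventually_at_split)
  with one_sided_slopes_has_derivative[OF assms]
  have "\<forall>\<^sub>F x in at v. (f has_real_derivative deriv f x) (at x) \<and> norm (deriv f x) < K"
    by eventually_elim auto
  then obtain e where "e > 0" and e: "\<And>x. x \<noteq> v \<Longrightarrow> dist x v < e \<Longrightarrow>
      (f has_real_derivative deriv f x) (at x) \<and> norm (deriv f x) < K"
    by (auto simp: eventually_at)
  have cont: "isCont f x" if "dist x v < e" for x
    using that e[of x] assms by (cases "x = v") (auto simp: one_sided_slopes_def DERIV_isCont)
  have away: "\<bar>f y - f x\<bar> \<le> K * (y - x)"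
    if "x \<le> y" "dist x v < e" "dist y v < e" "v \<notin> {x<..<y}" for x y
  proof (cases "x = y")
    case False
    then have "x < y" using that by simp
    have near: "dist t v < e" if "x \<le> t" "t \<le> y" for t
      using that \<open>dist x v < e\<close> \<open>dist y v < e\<close> by (auto simp: dist_real_def)
    have "continuous_on {x..y} f"
      using near cont by (auto intro!: continuous_at_imp_continuous_on)
    moreover have slope: "(f has_real_derivative deriv f t) (at t) \<and> norm (deriv f t) < K"
      if "x < t" "t < y" for t
      using that near[of t] e[of t] \<open>v \<notin> {x<..<y}\<close> by auto
    moreover have "f differentiable (at t)" if "x < t" "t < y" for t
      using slope[OF that] by (auto simp: real_differentiable_def)
    ultimately obtain d t where t: "x < t" "t < y" "(f has_real_derivative d) (at t)"
      "f y - f x = (y - x) * d"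
      using MVT[OF \<open>x < y\<close>, of f] by blast
    then have "\<bar>d\<bar> \<le> K" using slope[of t] by (auto simp: DERIV_imp_deriv)
    then show ?thesis
      using t(4) \<open>x < y\<close> by (simp add: abs_mult mult.commute mult_right_mono)
  qed simp
  \<comment> \<open>The mean value theorem fails across \<open>v\<close>, so an interval containing \<open>v\<close> is cut there.\<close>
  have "K-lipschitz_on (ball v e) f"
  proof (rule lipschitz_on_leI)
    fix x y assume xy: "x \<in> ball v e" "y \<in> ball v e" "x \<le> y"
    then have near: "dist x v < e" "dist y v < e" by (auto simp: dist_commute)
    have "\<bar>f y - f x\<bar> \<le> K * (y - x)"
    proof (cases "v \<in> {x<..<y}")
      case True
      then have "\<bar>f v - f x\<bar> \<le> K * (v - x)" "\<bar>f y - f v\<bar> \<le> K * (y - v)"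
        using near \<open>e > 0\<close> by (auto intro!: away)
      then show ?thesis by (simp add: algebra_simps)
    qed (use away xy near in auto)
    then show "dist (f x) (f y) \<le> K * dist x y"
      using xy by (simp add: dist_real_def abs_minus_commute)
  qed (simp add: K_def)
  then show ?thesis using \<open>e > 0\<close> by (auto simp: locally_lipschitz_at_def)
qed

text \<open>
  Stated for derivatives of negative sign, not for a limit of them, so that it also covers
  derivatives that tend to \<open>-\<infinity>\<close>.
\<close>

lemma minimizer_not_decreasing_right:
  fixes g :: "real \<Rightarrow> real"
  assumes "isCont g v" and D: "\<forall>\<^sub>F x in at_right v. (g has_real_derivative D x) (at x)"
    and "global_minimizer g v"
  shows "\<not> (\<forall>\<^sub>F x in at_right v. D x < 0)"
proof
  assume "\<forall>\<^sub>F x in at_right v. D x < 0"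
  with D have "\<forall>\<^sub>F x in at_right v. (g has_real_derivative D x) (at x) \<and> D x < 0"
    by eventually_elim auto
  then obtain c where "c > v" and c: "\<And>x. v < x \<Longrightarrow> x < c \<Longrightarrow>
      (g has_real_derivative D x) (at x) \<and> D x < 0"
    by (auto simp: eventually_at_right_field)
  define y where "y = (v + c) / 2"
  have y: "v < y" "y < c" using \<open>c > v\<close> by (auto simp: y_def)
  have "continuous_on {v..y} g"
  proof (intro continuous_at_imp_continuous_on ballI)
    fix x assume "x \<in> {v..y}"
    then show "isCont g x"
      using c[of x] y assms(1) by (cases "x = v") (auto intro: DERIV_isCont)
  qed
  moreover have "g differentiable (at x)" if "v < x" "x < y" for x
    using c[of x] that y by (auto simp: real_differentiable_def)
  ultimately obtain d t where t: "v < t" "t < y" "(g has_real_derivative d) (at t)"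
    "g y - g v = (y - v) * d"
    using MVT[OF \<open>v < y\<close>, of g] by blast
  have "d < 0"
    using c[of t] t(1,2) y DERIV_unique[OF t(3), of "D t"] by simp
  then have "g y < g v"
    using t(4) y mult_pos_neg[of "y - v" d] by simp
  then show False
    using assms(3) by (auto simp: global_minimizer_def is_arg_min_def)
qed

lemma minimizer_not_increasing_left:
  fixes g :: "real \<Rightarrow> real"
  assumes "isCont g v" and D: "\<forall>\<^sub>F x in at_left v. (g has_real_derivative D x) (at x)"
    and "global_minimizer g v"
  shows "\<not> (\<forall>\<^sub>F x in at_left v. D x > 0)"
proof -
  have "\<not> (\<forall>\<^sub>F x in at_right (- v). - D (- x) < 0)"
  proof (rule minimizer_not_decreasing_right)
    show "isCont (\<lambda>x. g (- x)) (- v)"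
      using assms(1) isCont_o2[of "- v" uminus g] by simp
    have "\<forall>\<^sub>F x in at_right (- v). (g has_real_derivative D (- x)) (at (- x))"
      using D unfolding at_left_minus eventually_filtermap .
    then show "\<forall>\<^sub>F x in at_right (- v). ((\<lambda>x. g (- x)) has_real_derivative - D (- x)) (at x)"
      by eventually_elim (simp add: DERIV_mirror)
    show "global_minimizer (\<lambda>x. g (- x)) (- v)"
      using assms(3) by (auto simp: global_minimizer_def is_arg_min_def)
  qed
  then show ?thesis unfolding at_left_minus eventually_filtermap by simp
qed

lemma global_minimizer_slopes:
  assumes "one_sided_slopes g v l r" and "global_minimizer g v"
  shows "l \<le> 0" and "0 \<le> r"
proof -
  have g: "isCont g v" "(deriv g \<longlongrightarrow> l) (at_left v)" "(deriv g \<longlongrightarrow> r) (at_right v)"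
    and D: "\<forall>\<^sub>F x in at_left v. (g has_real_derivative deriv g x) (at x)"
      "\<forall>\<^sub>F x in at_right v. (g has_real_derivative deriv g x) (at x)"
    using assms(1) one_sided_slopes_has_derivative[OF assms(1)]
    by (auto simp: one_sided_slopes_def eventually_at_split)
  show "l \<le> 0"
    using minimizer_not_increasing_left[OF g(1) D(1) assms(2)] order_tendstoD(1)[OF g(2), of 0]
    by force
  show "0 \<le> r"
    using minimizer_not_decreasing_right[OF g(1) D(2) assms(2)] order_tendstoD(2)[OF g(3), of 0]
    by force
qed

section \<open>Order statistics\<close>

text \<open>
  Counting entries below a threshold turns statements about the sorted list into inclusions between
  sets of indices.
\<close>

lemma order_stat_le_iff:
  fixes y :: "real ^ 'n"
  assumes "i \<in> {1..CARD('n)}"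
  shows "order_stat y i \<le> t \<longleftrightarrow> i \<le> card {j. y $ j \<le> t}"
proof -
  define xs where "xs = sorted_list_of_multiset (image_mset (\<lambda>j. y $ j) (mset_set UNIV))"
  have mset: "mset xs = image_mset (\<lambda>j. y $ j) (mset_set UNIV)" by (simp add: xs_def)
  have len: "length xs = CARD('n)"
    using arg_cong[OF mset, of size] by simp
  have sorted: "sorted xs" by (simp add: xs_def)
  have count: "card {j. y $ j \<le> t} = length (filter (\<lambda>x. x \<le> t) xs)"
  proof -
    have "length (filter (\<lambda>x. x \<le> t) xs) = size (filter_mset (\<lambda>x. x \<le> t) (mset xs))"
      by (metis mset_filter size_mset)
    also have "\<dots> = card {j. y $ j \<le> t}"
      by (simp add: mset filter_mset_image_mset)
    finally show ?thesis ..
  qed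
  have "xs ! (i - 1) \<le> t \<longleftrightarrow> i \<le> length (filter (\<lambda>x. x \<le> t) xs)"
  proof -
    have T: "filter (\<lambda>x. x \<le> t) xs = takeWhile (\<lambda>x. x \<le> t) xs"
      using sorted
    proof (induction xs)
      case (Cons x xs)
      then show ?case by (cases xs) (auto simp: filter_empty_conv)
    qed simp
    have i: "i - 1 < length xs" "i \<ge> 1" using assms len by auto
    show ?thesis
    proof
      assume le: "xs ! (i - 1) \<le> t"
      show "i \<le> length (filter (\<lambda>x. x \<le> t) xs)"
      proof (rule ccontr)
        assume "\<not> ?thesis"
        then have k: "length (takeWhile (\<lambda>x. x \<le> t) xs) \<le> i - 1" by (simp add: T)
        then have "xs ! length (takeWhile (\<lambda>x. x \<le> t) xs) \<le> t"
          using le sorted_nth_mono[OF sorted k i(1)] by simp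
        then show False
          using nth_length_takeWhile[of "\<lambda>x. x \<le> t" xs] k i by simp
      qed
    next
      assume "i \<le> length (filter (\<lambda>x. x \<le> t) xs)"
      then have "i - 1 < length (takeWhile (\<lambda>x. x \<le> t) xs)" using i(2) by (simp add: T)
      then show "xs ! (i - 1) \<le> t"
        using nth_mem set_takeWhileD takeWhile_nth by metis
    qed
  qed
  then show ?thesis by (simp add: order_stat_def xs_def[symmetric] count)
qed

text \<open>
  Moving every entry by at most \<open>dist y z\<close> shifts the counting function by at most that much, so order
  statistics are 1-Lipschitz.
\<close>

lemma order_stat_diff_le:
  fixes y z :: "real ^ 'n"
  assumes "i \<in> {1..CARD('n)}"
  shows "\<bar>order_stat y i - order_stat z i\<bar> \<le> dist y z"
proof -
  have *: "order_stat z i \<le> order_stat y i + dist y z" for y z :: "real ^ 'n"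
  proof -
    have "z $ j \<le> t + dist y z" if "y $ j \<le> t" for j t
      using that dist_vec_nth_le[of y j z] by (auto simp: dist_real_def)
    then have "{j. y $ j \<le> order_stat y i} \<subseteq> {j. z $ j \<le> order_stat y i + dist y z}"
      by auto
    then have "card {j. y $ j \<le> order_stat y i} \<le> card {j. z $ j \<le> order_stat y i + dist y z}"
      by (intro card_mono) auto
    then show ?thesis
      using order_stat_le_iff[OF assms, of y "order_stat y i"] order_stat_le_iff[OF assms, of z]
      by simp
  qed
  show ?thesis using *[of y z] *[of z y] by (auto simp: dist_commute)
qed

text \<open>
  At least \<open>q j\<close> entries are at most \<open>y $ j\<close>, and fewer than \<open>q j\<close> are below it; with ties, this holds
  for every ranking \<open>q\<close> compatible with the values.
\<close>

lemma order_stat_eq_nth: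
  fixes y :: "real ^ 'n" and q :: "'n \<Rightarrow> nat"
  assumes q: "bij_betw q UNIV {1..CARD('n)}"
    and mono: "\<And>j k. q j \<le> q k \<Longrightarrow> y $ j \<le> y $ k"
  shows "order_stat y (q j) = y $ j"
proof -
  have qj: "q j \<in> {1..CARD('n)}" using q by (auto simp: bij_betw_def)
  have card: "card {k. q k \<le> m} = m" if "m \<le> CARD('n)" for m
  proof -
    have "q ` {k. q k \<le> m} = {1..CARD('n)} \<inter> {..m}"
      using bij_betw_imp_surj_on[OF q, symmetric] by auto
    also have "\<dots> = {1..m}" using that by auto
    finally have "bij_betw q {k. q k \<le> m} {1..m}"
      using inj_on_subset[OF bij_betw_imp_inj_on[OF q]] by (intro bij_betw_imageI) auto
    from bij_betw_same_card[OF this] show ?thesis by simp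
  qed
  have "card {k. q k \<le> q j} \<le> card {k. y $ k \<le> y $ j}"
    using mono by (intro card_mono) auto
  then have le: "order_stat y (q j) \<le> y $ j"
    using qj card by (simp add: order_stat_le_iff[OF qj])
  have "\<not> order_stat y (q j) < y $ j"
  proof
    assume lt: "order_stat y (q j) < y $ j"
    have "q j \<le> card {k. y $ k \<le> order_stat y (q j)}"
      using order_stat_le_iff[OF qj] by blast
    also have "\<dots> \<le> card {k. q k \<le> q j - 1}"
    proof (intro card_mono)
      show "{k. y $ k \<le> order_stat y (q j)} \<subseteq> {k. q k \<le> q j - 1}"
      proof safe
        fix k assume "y $ k \<le> order_stat y (q j)"
        then have "\<not> q j \<le> q k" using mono[of j k] lt by auto
        then show "q k \<le> q j - 1" by simp
      qed
    qed simp
    also have "\<dots> = q j - 1" using qj by (intro card) auto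
    finally show False using qj by auto
  qed
  with le show ?thesis by simp
qed

section \<open>Sorted costs near a sorted point\<close>

text \<open>
  The order statistics are 1-Lipschitz and equal \<open>v i\<close> at the given point, so nearby they stay in the
  neighbourhoods of the \<open>v i\<close> on which the \<open>f i\<close> are Lipschitz.
\<close>

lemma sorted_cost_locally_lipschitz:
  fixes q :: "'n::finite \<Rightarrow> nat"
  assumes q: "bij_betw q UNIV {1..CARD('n)}" and mono: "mono_on {1..CARD('n)} v"
    and lip: "\<And>i. i \<in> {1..CARD('n)} \<Longrightarrow> locally_lipschitz_at (f i) (v i)"
  shows "locally_lipschitz_at (sorted_cost f) (\<chi> j::'n. v (q j))"
proof -
  define x where "x = (\<chi> j::'n. v (q j))"
  have os: "order_stat x i = v i" if i: "i \<in> {1..CARD('n)}" for i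
  proof -
    obtain j where j: "i = q j" using i bij_betw_imp_surj_on[OF q] by blast
    have "order_stat x (q j) = x $ j"
      using bij_betw_apply[OF q]
      by (intro order_stat_eq_nth[OF q]) (auto simp: x_def intro: mono_onD[OF mono])
    then show ?thesis by (simp add: j x_def)
  qed
  obtain e L where e: "\<And>i. i \<in> {1..CARD('n)} \<Longrightarrow> e i > 0"
    and L: "\<And>i. i \<in> {1..CARD('n)} \<Longrightarrow> (L i)-lipschitz_on (ball (v i) (e i)) (f i)"
    using lip unfolding locally_lipschitz_at_def by metis
  define e0 where "e0 = Min (e ` {1..CARD('n)})"
  have "e0 > 0" using e by (simp add: e0_def)
  have ball: "order_stat y i \<in> ball (v i) (e i)" if "y \<in> ball x e0" "i \<in> {1..CARD('n)}" for y i
  proof -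
    have "e0 \<le> e i" using that(2) by (auto simp: e0_def)
    then show ?thesis
      using order_stat_diff_le[OF that(2), of x y] that by (simp add: os dist_real_def)
  qed
  have "(\<Sum>i=1..CARD('n). L i)-lipschitz_on (ball x e0) (sorted_cost f)"
  proof (rule lipschitz_onI)
    fix y z assume yz: "y \<in> ball x e0" "z \<in> ball x e0"
    have "dist (sorted_cost f y) (sorted_cost f z)
        \<le> (\<Sum>i=1..CARD('n). \<bar>f i (order_stat y i) - f i (order_stat z i)\<bar>)"
      unfolding sorted_cost_def dist_real_def sum_subtractf[symmetric] by (rule sum_abs)
    also have "\<dots> \<le> (\<Sum>i=1..CARD('n). L i * dist y z)"
    proof (rule sum_mono)
      fix i assume i: "i \<in> {1..CARD('n)}"
      have "\<bar>f i (order_stat y i) - f i (order_stat z i)\<bar> \<le> L i * \<bar>order_stat y i - order_stat z i\<bar>"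
        using lipschitz_onD[OF L[OF i] ball[OF yz(1) i] ball[OF yz(2) i]]
        by (simp add: dist_real_def)
      also have "\<dots> \<le> L i * dist y z"
        using order_stat_diff_le[OF i, of y z] lipschitz_on_nonneg[OF L[OF i]]
        by (intro mult_left_mono) auto
      finally show "\<bar>f i (order_stat y i) - f i (order_stat z i)\<bar> \<le> L i * dist y z" .
    qed
    finally show "dist (sorted_cost f y) (sorted_cost f z) \<le> (\<Sum>i=1..CARD('n). L i) * dist y z"
      by (simp add: sum_distrib_right)
  qed (use lipschitz_on_nonneg[OF L] in \<open>auto intro!: sum_nonneg\<close>)
  then show ?thesis using \<open>e0 > 0\<close> by (auto simp: locally_lipschitz_at_def x_def)
qed

text \<open>
  At a point with distinct entries the ranks \<open>q\<close> do not change nearby, so the sorted cost is locally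
  the separable sum of the \<open>f (q j) (z $ j)\<close>.
\<close>

lemma sorted_cost_GDERIV:
  fixes y :: "real ^ 'n" and q :: "'n \<Rightarrow> nat"
  assumes q: "bij_betw q UNIV {1..CARD('n)}"
    and less: "\<And>j k. q j < q k \<Longrightarrow> y $ j < y $ k"
    and D: "\<And>j. (f (q j) has_real_derivative D j) (at (y $ j))"
  shows "GDERIV (sorted_cost f) y :> (\<chi> j. D j)"
proof -
  define S where "S = (\<Inter>j. \<Inter>k\<in>{k. q j < q k}. {z :: real ^ 'n. z $ j < z $ k})"
  have "open S"
    unfolding S_def by (intro open_INT ballI open_Collect_less continuous_intros) auto
  have "y \<in> S" using less by (auto simp: S_def)
  have eq: "(\<Sum>j\<in>UNIV. f (q j) (z $ j)) = sorted_cost f z" if "z \<in> S" for z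
  proof -
    have "order_stat z (q j) = z $ j" for j
    proof (rule order_stat_eq_nth[OF q])
      fix j k assume "q j \<le> q k"
      then consider "j = k" | "q j < q k"
        using q by (auto simp: bij_betw_def inj_on_def le_less)
      then show "z $ j \<le> z $ k" using that by cases (auto simp: S_def intro: less_imp_le)
    qed
    then have "(\<Sum>j\<in>UNIV. f (q j) (z $ j)) = (\<Sum>j\<in>UNIV. f (q j) (order_stat z (q j)))" by simp
    then show ?thesis
      using sum.reindex_bij_betw[OF q, of "\<lambda>i. f i (order_stat z i)"]
      by (simp add: sorted_cost_def)
  qed
  have "((\<lambda>z :: real ^ 'n. \<Sum>j\<in>UNIV. f (q j) (z $ j)) has_derivative
      (\<lambda>h. \<Sum>j\<in>UNIV. h $ j * D j)) (at y)"
  proof (rule has_derivative_sum)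
    fix j
    show "((\<lambda>z :: real ^ 'n. f (q j) (z $ j)) has_derivative (\<lambda>h. h $ j * D j)) (at y)"
      using has_derivative_compose[OF bounded_linear.has_derivative[OF bounded_linear_vec_nth has_derivative_ident]
          D[of j, unfolded has_field_derivative_def]]
      by (simp add: mult.commute)
  qed
  from has_derivative_transform_within_open[OF this \<open>open S\<close> \<open>y \<in> S\<close> eq]
  show ?thesis by (simp add: gderiv_def inner_vec_def)
qed

text \<open>
  The set whose convex hull is the Clarke gradient.
\<close>

definition gradient_limits :: "('a::euclidean_space \<Rightarrow> real) \<Rightarrow> 'a \<Rightarrow> 'a set" where
  "gradient_limits h x =
     {g. \<exists>X G. X \<longlonglongrightarrow> x \<and> (\<forall>k::nat. GDERIV h (X k) :> G k) \<and> G \<longlonglongrightarrow> g}"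

lemma gradient_limitsI:
  fixes X G :: "real \<Rightarrow> 'a::euclidean_space"
  assumes "(X \<longlongrightarrow> x) (at_right 0)" "(G \<longlongrightarrow> g) (at_right 0)"
    and ev: "\<forall>\<^sub>F s in at_right 0. GDERIV h (X s) :> G s"
  shows "g \<in> gradient_limits h x"
proof -
  obtain c where c: "c > 0" "\<And>s. 0 < s \<Longrightarrow> s < c \<Longrightarrow> GDERIV h (X s) :> G s"
    using ev by (auto simp: eventually_at_right_field)
  \<comment> \<open>The offset \<open>2\<close> keeps every \<open>s k\<close>, including \<open>s 0\<close>, strictly below \<open>c\<close>.\<close>
  define s where "s k = c / real (k + 2)" for k
  have "s k > 0" "s k < c" for k
    using c(1) by (auto simp: s_def field_simps intro: add_pos_nonneg)
  moreover have "s \<longlonglongrightarrow> 0"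
    unfolding s_def using LIMSEQ_ignore_initial_segment[OF lim_const_over_n[of c], of 2] by simp
  ultimately have lim: "filterlim s (at_right 0) sequentially"
    by (auto intro!: tendsto_imp_filterlim_at_right)
  show ?thesis unfolding gradient_limits_def mem_Collect_eq
    using c(2) \<open>\<And>k. s k > 0\<close> \<open>\<And>k. s k < c\<close>
      filterlim_compose[OF assms(1) lim] filterlim_compose[OF assms(2) lim]
    by (intro exI[of _ "\<lambda>k. X (s k)"] exI[of _ "\<lambda>k. G (s k)"]) auto
qed

text \<open>
  The ties of \<open>v\<close> are broken by moving the entry of rank \<open>i\<close> to \<open>v i + s * d i\<close>. As \<open>v\<close> is nondecreasing
  and \<open>d\<close> strictly increasing, these numbers are strictly increasing in \<open>i\<close> for every \<open>s > 0\<close>.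
\<close>

lemma spread_gradient_limit:
  fixes q :: "'n::finite \<Rightarrow> nat" and d :: "nat \<Rightarrow> real"
  assumes q: "bij_betw q UNIV {1..CARD('n)}" and mono: "mono_on {1..CARD('n)} v"
    and d: "strict_mono d"
    and diff: "\<And>i. i \<in> {1..CARD('n)} \<Longrightarrow>
      \<forall>\<^sub>F s in at_right 0. (f i has_real_derivative deriv (f i) (v i + s * d i)) (at (v i + s * d i))"
    and lim: "\<And>i. i \<in> {1..CARD('n)} \<Longrightarrow>
      ((\<lambda>s. deriv (f i) (v i + s * d i)) \<longlongrightarrow> g i) (at_right 0)"
  shows "(\<chi> j. g (q j)) \<in> gradient_limits (sorted_cost f) (\<chi> j::'n. v (q j))"
proof (rule gradient_limitsI)
  have q_in: "q j \<in> {1..CARD('n)}" for j using q by (auto simp: bij_betw_def)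
  show "((\<lambda>s. \<chi> j. v (q j) + s * d (q j)) \<longlongrightarrow> (\<chi> j. v (q j))) (at_right 0)"
    by (rule vec_tendstoI) (auto intro!: tendsto_eq_intros)
  show "((\<lambda>s. \<chi> j. deriv (f (q j)) (v (q j) + s * d (q j))) \<longlongrightarrow> (\<chi> j. g (q j))) (at_right 0)"
    using lim q_in by (intro vec_tendstoI) simp
  have "\<forall>\<^sub>F s in at_right 0. \<forall>j. (f (q j) has_real_derivative
      deriv (f (q j)) (v (q j) + s * d (q j))) (at (v (q j) + s * d (q j)))"
    using diff q_in by (intro eventually_all_finite) auto
  with eventually_at_right_less[of 0]
  show "\<forall>\<^sub>F s in at_right 0. GDERIV (sorted_cost f) (\<chi> j. v (q j) + s * d (q j)) :>
      (\<chi> j. deriv (f (q j)) (v (q j) + s * d (q j)))"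
  proof eventually_elim
    case (elim s)
    show ?case
    proof (rule sorted_cost_GDERIV[OF q])
      fix j k assume less: "q j < q k"
      have "v (q j) \<le> v (q k)" using mono_onD[OF mono q_in q_in] less by simp
      moreover have "s * d (q j) < s * d (q k)"
        using strict_monoD[OF d less] elim(1) by simp
      ultimately show "(\<chi> j. v (q j) + s * d (q j)) $ j < (\<chi> j. v (q j) + s * d (q j)) $ k"
        by simp
    qed (use elim in auto)
  qed
qed

lemma filterlim_add_scaled_at_left:
  "d < 0 \<Longrightarrow> filterlim (\<lambda>s. v + s * d) (at_left v) (at_right (0::real))" for v d :: real
  by (rule tendsto_imp_filterlim_at_left)
    (auto intro!: tendsto_eq_intros eventually_at_rightI[of 0 1] simp: mult_pos_neg)

lemma filterlim_add_scaled_at_right: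
  "d > 0 \<Longrightarrow> filterlim (\<lambda>s. v + s * d) (at_right v) (at_right (0::real))" for v d :: real
  by (rule tendsto_imp_filterlim_at_right)
    (auto intro!: tendsto_eq_intros eventually_at_rightI[of 0 1])

text \<open>
  Breaking ties with offsets that are all negative selects the left slopes; with offsets that are all
  positive, the right slopes.
\<close>

lemma slopes_in_gradient_limits:
  fixes q :: "'n::finite \<Rightarrow> nat"
  assumes q: "bij_betw q UNIV {1..CARD('n)}" and mono: "mono_on {1..CARD('n)} v"
    and slopes: "\<And>i. i \<in> {1..CARD('n)} \<Longrightarrow> one_sided_slopes (f i) (v i) (l i) (r i)"
  shows "(\<chi> j. l (q j)) \<in> gradient_limits (sorted_cost f) (\<chi> j::'n. v (q j))"
    and "(\<chi> j. r (q j)) \<in> gradient_limits (sorted_cost f) (\<chi> j::'n. v (q j))"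
proof -
  have ev: "\<forall>\<^sub>F x in at_left (v i). (f i has_real_derivative deriv (f i) x) (at x)"
      "\<forall>\<^sub>F x in at_right (v i). (f i has_real_derivative deriv (f i) x) (at x)"
    and lim: "(deriv (f i) \<longlongrightarrow> l i) (at_left (v i))" "(deriv (f i) \<longlongrightarrow> r i) (at_right (v i))"
    if "i \<in> {1..CARD('n)}" for i
    using one_sided_slopes_has_derivative[OF slopes[OF that]] slopes[OF that]
    by (auto simp: one_sided_slopes_def eventually_at_split)
  \<comment> \<open>Strictly increasing in \<open>i\<close>, and negative up to \<open>i = CARD('n)\<close>.\<close>
  define dl where "dl i = real i - real (CARD('n) + 1)" for i
  have dl: "filterlim (\<lambda>s. v i + s * dl i) (at_left (v i)) (at_right 0)"
    if "i \<in> {1..CARD('n)}" for i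
    using that by (intro filterlim_add_scaled_at_left) (auto simp: dl_def)
  show "(\<chi> j. l (q j)) \<in> gradient_limits (sorted_cost f) (\<chi> j::'n. v (q j))"
  proof (rule spread_gradient_limit[OF q mono, of dl])
    show "strict_mono dl" by (auto simp: dl_def strict_mono_def)
  qed (rule eventually_compose_filterlim[OF ev(1) dl] filterlim_compose[OF lim(1) dl]; assumption)+
  have dr: "filterlim (\<lambda>s. v i + s * real i) (at_right (v i)) (at_right 0)"
    if "i \<in> {1..CARD('n)}" for i
    using that by (intro filterlim_add_scaled_at_right) auto
  show "(\<chi> j. r (q j)) \<in> gradient_limits (sorted_cost f) (\<chi> j::'n. v (q j))"
  proof (rule spread_gradient_limit[OF q mono, of real])
    show "strict_mono real" by (auto simp: strict_mono_def)
  qed (rule eventually_compose_filterlim[OF ev(2) dr] filterlim_compose[OF lim(2) dr]; assumption)+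
qed

section \<open>Averaging over level classes\<close>

text \<open>The conditional expectation of \<open>F\<close> given \<open>v\<close>, for the uniform distribution on the indices.\<close>

definition class_mean :: "('n::finite \<Rightarrow> 'b) \<Rightarrow> ('n \<Rightarrow> real) \<Rightarrow> 'n \<Rightarrow> real" where
  "class_mean v F j = (\<Sum>k | v k = v j. F k) / card {k. v k = v j}"

text \<open>
  Average over the group \<open>P\<close> of all permutations that preserve \<open>v\<close>. Composing with the transposition of
  two indices of one class shows that the average is constant on classes, and each permutation leaves
  the sum over a class unchanged; these two facts determine the average.
\<close>

lemma class_mean_in_convex_hull:
  fixes v :: "'n::finite \<Rightarrow> 'b" and F :: "'n \<Rightarrow> real"
  shows "(\<chi> j. class_mean v F j) \<in>
    convex hull ((\<lambda>p. \<chi> j. F (p j)) ` {p. bij p \<and> (\<forall>j. v (p j) = v j)})"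
proof -
  define P where "P = {p. bij p \<and> (\<forall>j. v (p j) = v j)}"
  have "finite P" by simp
  have "id \<in> P" by (simp add: P_def)
  then have card_P: "card P > 0" using \<open>finite P\<close> by (auto simp: card_gt_0_iff)
  have swap: "(\<Sum>p\<in>P. F (p k)) = (\<Sum>p\<in>P. F (p j))" if "v k = v j" for j k
  proof (rule sum.reindex_bij_witness[where i = "\<lambda>p. p \<circ> Transposition.transpose j k"
        and j = "\<lambda>p. p \<circ> Transposition.transpose j k"])
    have vt: "v (Transposition.transpose j k i) = v i" for i
      using that by (auto simp: Transposition.transpose_def)
    show "p \<circ> Transposition.transpose j k \<in> P" if "p \<in> P" for p
      using that vt by (auto simp: P_def intro!: bij_comp)
    then show "p \<circ> Transposition.transpose j k \<in> P" if "p \<in> P" for p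
      using that by blast
  qed (auto simp: comp_assoc)
  have mean: "class_mean v F j = (\<Sum>p\<in>P. (1 / card P) * F (p j))" for j
  proof -
    define C where "C = {k. v k = v j}"
    have "j \<in> C" by (simp add: C_def)
    then have card_C: "card C > 0" by (auto simp: card_gt_0_iff)
    have perm: "(\<Sum>k\<in>C. F (p k)) = (\<Sum>k\<in>C. F k)" if "p \<in> P" for p
    proof (rule sum.reindex_bij_betw)
      have "inj_on p C" "p ` C \<subseteq> C" using that by (auto simp: P_def C_def bij_def inj_on_def)
      then show "bij_betw p C C" by (simp add: bij_betw_def endo_inj_surj)
    qed
    have "card C * (\<Sum>p\<in>P. F (p j)) = (\<Sum>k\<in>C. \<Sum>p\<in>P. F (p k))"
    proof -
      have "(\<Sum>k\<in>C. \<Sum>p\<in>P. F (p k)) = (\<Sum>k\<in>C. \<Sum>p\<in>P. F (p j))"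
        by (rule sum.cong[OF refl], rule swap) (simp add: C_def)
      then show ?thesis by simp
    qed
    also have "\<dots> = (\<Sum>p\<in>P. \<Sum>k\<in>C. F (p k))" by (rule sum.swap)
    also have "\<dots> = card P * (\<Sum>k\<in>C. F k)" by (simp add: perm)
    finally have "(\<Sum>k\<in>C. F k) * card P = (\<Sum>p\<in>P. F (p j)) * card C"
      by (simp only: mult.commute)
    moreover have "real (card C) \<noteq> 0" "real (card P) \<noteq> 0"
      using card_C card_P by (simp_all only: of_nat_eq_0_iff)
    ultimately have "(\<Sum>k\<in>C. F k) / card C = (\<Sum>p\<in>P. F (p j)) / card P"
      by (metis frac_eq_eq)
    then show ?thesis
      by (simp add: class_mean_def C_def[symmetric] sum_divide_distrib[symmetric])
  qed
  have "(\<Sum>p\<in>P. (1 / card P) *\<^sub>R (\<chi> j. F (p j))) \<in> convex hull ((\<lambda>p. \<chi> j. F (p j)) ` P)"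
    using card_P by (intro convex_sum \<open>finite P\<close>) (auto intro: hull_inc)
  also have "(\<Sum>p\<in>P. (1 / card P) *\<^sub>R (\<chi> j. F (p j))) = (\<chi> j. class_mean v F j)"
    by (simp add: vec_eq_iff mean)
  finally show ?thesis by (simp add: P_def)
qed

lemma class_mean_in_clarke_gradient:
  fixes q :: "'n::finite \<Rightarrow> nat"
  assumes q: "bij_betw q UNIV {1..CARD('n)}"
    and limit: "\<And>q. bij_betw q UNIV {1..CARD('n)} \<Longrightarrow>
      (\<chi> j. g (q j)) \<in> gradient_limits h (\<chi> j::'n. v (q j))"
  shows "(\<chi> j. class_mean (v \<circ> q) (g \<circ> q) j) \<in> clarke_gradient h (\<chi> j::'n. v (q j))"
proof -
  have "(\<lambda>p. \<chi> j. (g \<circ> q) (p j)) ` {p. bij p \<and> (\<forall>j. (v \<circ> q) (p j) = (v \<circ> q) j)}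
      \<subseteq> gradient_limits h (\<chi> j. v (q j))"
  proof safe
    fix p :: "'n \<Rightarrow> 'n" assume p: "bij p" "\<forall>j. (v \<circ> q) (p j) = (v \<circ> q) j"
    then have "bij_betw (q \<circ> p) UNIV {1..CARD('n)}"
      using q by (intro bij_betw_trans)
    from limit[OF this] show "(\<chi> j. (g \<circ> q) (p j)) \<in> gradient_limits h (\<chi> j. v (q j))"
      using p(2) by simp
  qed
  from hull_mono[OF this] class_mean_in_convex_hull[of "v \<circ> q" "g \<circ> q"]
  show ?thesis by (auto simp: clarke_gradient_def gradient_limits_def)
qed

text \<open>
  The means of the left and of the right slopes vanish on every class except possibly the one of
  value \<open>B\<close>. As there is only one exceptional class, a single weight \<open>t\<close> balances the two vectors.
\<close>

lemma zero_in_clarke_gradient_sorted_cost: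
  fixes q :: "'n::finite \<Rightarrow> nat"
  assumes q: "bij_betw q UNIV {1..CARD('n)}" and mono: "mono_on {1..CARD('n)} v"
    and slopes: "\<And>i. i \<in> {1..CARD('n)} \<Longrightarrow> one_sided_slopes (f i) (v i) (l i) (r i)"
    and smooth: "\<And>i. i \<in> {1..CARD('n)} \<Longrightarrow> v i \<noteq> B \<Longrightarrow> l i = r i"
    and left: "\<And>c. (\<Sum>i | i \<in> {1..CARD('n)} \<and> v i = c. l i) \<le> 0"
    and right: "\<And>c. 0 \<le> (\<Sum>i | i \<in> {1..CARD('n)} \<and> v i = c. r i)"
  shows "0 \<in> clarke_gradient (sorted_cost f) (\<chi> j::'n. v (q j))"
proof -
  let ?C = "clarke_gradient (sorted_cost f) (\<chi> j::'n. v (q j))"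
  define L where "L = (\<Sum>i | i \<in> {1..CARD('n)} \<and> v i = B. l i)"
  define R where "R = (\<Sum>i | i \<in> {1..CARD('n)} \<and> v i = B. r i)"
  have reindex: "(\<Sum>k | v (q k) = c. g (q k)) = (\<Sum>i | i \<in> {1..CARD('n)} \<and> v i = c. g i)"
    for c and g :: "nat \<Rightarrow> real"
  proof (rule sum.reindex_bij_betw)
    have "q ` {k. v (q k) = c} = {i. i \<in> {1..CARD('n)} \<and> v i = c}"
      unfolding bij_betw_imp_surj_on[OF q, symmetric] by blast
    then show "bij_betw q {k. v (q k) = c} {i. i \<in> {1..CARD('n)} \<and> v i = c}"
      using inj_on_subset[OF bij_betw_imp_inj_on[OF q]] by (intro bij_betw_imageI) auto
  qed
  have zl: "(\<chi> j. class_mean (v \<circ> q) (l \<circ> q) j) \<in> ?C" (is "?zl \<in> _")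
    using slopes_in_gradient_limits(1)[OF _ mono slopes]
    by (intro class_mean_in_clarke_gradient[OF q]) auto
  have zr: "(\<chi> j. class_mean (v \<circ> q) (r \<circ> q) j) \<in> ?C" (is "?zr \<in> _")
    using slopes_in_gradient_limits(2)[OF _ mono slopes]
    by (intro class_mean_in_clarke_gradient[OF q]) auto
  have "L \<le> 0" "0 \<le> R" using left right by (auto simp: L_def R_def)
  then have "closed_segment L R = {L..R}" by (simp add: closed_segment_eq_real_ivl)
  with \<open>L \<le> 0\<close> \<open>0 \<le> R\<close> obtain t where t: "0 \<le> t" "t \<le> 1" "(1 - t) * L + t * R = 0"
    by (auto simp: closed_segment_def dest!: equalityD2 subsetD[of _ _ 0])
  have "(1 - t) *\<^sub>R ?zl + t *\<^sub>R ?zr = 0"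
  proof (rule vec_eq_iff[THEN iffD2], rule allI)
    fix j
    have sums: "(1 - t) * (\<Sum>k | v (q k) = v (q j). l (q k)) + t * (\<Sum>k | v (q k) = v (q j). r (q k)) = 0"
    proof (cases "v (q j) = B")
      case True
      then show ?thesis using t(3) by (simp only: reindex L_def R_def)
    next
      case False
      have "(\<Sum>i | i \<in> {1..CARD('n)} \<and> v i = v (q j). l i) = (\<Sum>i | i \<in> {1..CARD('n)} \<and> v i = v (q j). r i)"
        using False smooth by (intro sum.cong) auto
      then have "(\<Sum>i | i \<in> {1..CARD('n)} \<and> v i = v (q j). l i) = 0"
        "(\<Sum>i | i \<in> {1..CARD('n)} \<and> v i = v (q j). r i) = 0"
        using left[of "v (q j)"] right[of "v (q j)"] by linarith+
      then show ?thesis by (simp only: reindex)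
    qed
    have "((1 - t) *\<^sub>R ?zl + t *\<^sub>R ?zr) $ j = ((1 - t) * (\<Sum>k | v (q k) = v (q j). l (q k))
        + t * (\<Sum>k | v (q k) = v (q j). r (q k))) / card {k. v (q k) = v (q j)}"
      by (simp add: class_mean_def add_divide_distrib)
    then show "((1 - t) *\<^sub>R ?zl + t *\<^sub>R ?zr) $ j = 0 $ j" by (simp add: sums)
  qed
  moreover have "convex ?C" by (simp add: clarke_gradient_def)
  ultimately show ?thesis
    using convexD[OF _ zl zr, of "1 - t" t] t by simp
qed

section \<open>Pooling adjacent violators\<close>

text \<open>
  An invariant of the algorithm: a merge replaces two blocks by their union, so the blocks remain a
  partition, and the new block receives a minimizer of its own cost.
\<close>

lemma pav_reachable_partition:
  assumes "pav_reachable f N J V"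
  shows "finite J \<and> (\<Union>(m, n)\<in>J. {m..n}) = {1..N} \<and> disjoint_family_on (\<lambda>(m, n). {m..n}) J \<and>
    (\<forall>(m, n)\<in>J. m \<le> n \<and> global_minimizer (block_cost f m n) (V (m, n)))"
  using assms
proof induction
  case (init V)
  have "block_cost f i i = f i" for i by (auto simp: block_cost_def)
  with init show ?case by (auto simp: disjoint_family_on_def)
next
  case (merge J V m n p v)
  let ?K = "J - {(m, n), (n + 1, p)}"
  have fin: "finite J" and cover: "(\<Union>(m, n)\<in>J. {m..n}) = {1..N}"
    and disj: "\<And>A B. A \<in> J \<Longrightarrow> B \<in> J \<Longrightarrow> A \<noteq> B \<Longrightarrow> {fst A..snd A} \<inter> {fst B..snd B} = {}"
    and minimizer: "\<And>m n. (m, n) \<in> J \<Longrightarrow> m \<le> n \<and> global_minimizer (block_cost f m n) (V (m, n))"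
  proof -
    show "finite J" and "(\<Union>(m, n)\<in>J. {m..n}) = {1..N}" using merge.IH by blast+
    show "{fst A..snd A} \<inter> {fst B..snd B} = {}" if "A \<in> J" "B \<in> J" "A \<noteq> B" for A B
      using merge.IH that unfolding disjoint_family_on_def case_prod_unfold by blast
    show "m \<le> n \<and> global_minimizer (block_cost f m n) (V (m, n))" if "(m, n) \<in> J" for m n
      using merge.IH that by blast
  qed
  have le: "m \<le> n" "n + 1 \<le> p" using minimizer merge.hyps by auto
  then have "m \<le> p" by simp
  have pool: "{m..p} = {m..n} \<union> {n + 1..p}" using le by auto
  have "J = insert (m, n) (insert (n + 1, p) ?K)" using merge.hyps by blast
  then have "(\<Union>(m, n)\<in>J. {m..n}) = {m..n} \<union> ({n + 1..p} \<union> (\<Union>(m, n)\<in>?K. {m..n}))"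
    by (metis (no_types, lifting) UN_insert case_prod_conv)
  then have "(\<Union>(m, n)\<in>insert (m, p) ?K. {m..n}) = {1..N}"
    unfolding cover by (simp add: pool Un_assoc)
  moreover have "disjoint_family_on (\<lambda>(m, n). {m..n}) (insert (m, p) ?K)"
  proof -
    have new: "{m..p} \<inter> {fst A..snd A} = {}" if "A \<in> ?K" for A
      using disj[of "(m, n)" A] disj[of "(n + 1, p)" A] that merge.hyps unfolding pool by auto
    show ?thesis
      unfolding disjoint_family_on_def case_prod_unfold
    proof (intro ballI impI)
      fix A B assume AB: "A \<in> insert (m, p) ?K" "B \<in> insert (m, p) ?K" "A \<noteq> B"
      show "{fst A..snd A} \<inter> {fst B..snd B} = {}"
        using AB disj[of A B] new[of A] new[of B] by (auto simp: Int_commute)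
    qed
  qed
  moreover have "\<forall>(i, k)\<in>insert (m, p) ?K.
      i \<le> k \<and> global_minimizer (block_cost f i k) ((V((m, p) := v)) (i, k))"
    using minimizer \<open>m \<le> p\<close> merge.hyps by auto
  ultimately show ?case using fin by simp
qed

lemma pav_returns_blocks:
  assumes "pav_returns f N ybar"
  obtains J where "finite J" and "(\<Union>(m, n)\<in>J. {m..n}) = {1..N}"
    and "disjoint_family_on (\<lambda>(m, n). {m..n}) J"
    and "\<And>m n i. (m, n) \<in> J \<Longrightarrow> i \<in> {m..n} \<Longrightarrow> global_minimizer (block_cost f m n) (ybar i)"
    and "\<And>m n i. (m, n) \<in> J \<Longrightarrow> i \<in> {m..n} \<Longrightarrow> ybar i = ybar m"
    and "mono_on {1..N} ybar"
proof -
  from assms obtain J V where reach: "pav_reachable f N J V"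
    and stop: "\<not> (\<exists>m n p. (m, n) \<in> J \<and> (n + 1, p) \<in> J \<and> V (m, n) > V (n + 1, p))"
    and val: "\<And>m n i. (m, n) \<in> J \<Longrightarrow> i \<in> {m..n} \<Longrightarrow> ybar i = V (m, n)"
    unfolding pav_returns_def by blast
  note part = pav_reachable_partition[OF reach]
  have block: "\<exists>m n. (m, n) \<in> J \<and> i \<in> {m..n}" if "i \<in> {1..N}" for i
    using part that by blast
  have same: "A = B" if "A \<in> J" "B \<in> J" "i \<in> {fst A..snd A}" "i \<in> {fst B..snd B}" for A B i
    using part that unfolding disjoint_family_on_def case_prod_unfold by blast
  have step: "ybar i \<le> ybar (Suc i)" if i: "1 \<le> i" "Suc i \<le> N" for i
  proof -
    obtain m n where mn: "(m, n) \<in> J" "i \<in> {m..n}" using block[of i] i by auto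
    obtain m' p where mp: "(m', p) \<in> J" "Suc i \<in> {m'..p}" using block[of "Suc i"] i by auto
    show ?thesis
    proof (cases "i < n")
      case True
      then have "Suc i \<in> {m..n}" using mn by auto
      then show ?thesis using val[OF mn(1)] mn(2) by simp
    next
      case False
      then have "i = n" using mn by auto
      \<comment> \<open>Blocks are disjoint, so the block of \<open>i + 1\<close> starts right after the one that ends at \<open>i\<close>;
        the two are adjacent and the stopping condition compares their values.\<close>
      have "m' = n + 1"
      proof (rule ccontr)
        assume "m' \<noteq> n + 1"
        then have "(m, n) = (m', p)"
          using mp mn \<open>i = n\<close> by (intro same[of _ _ i]) auto
        then show False using mp \<open>i = n\<close> by auto
      qed
      then have "V (m, n) \<le> V (n + 1, p)" using stop mn mp by force
      then show ?thesis using val[OF mn] val[OF mp] \<open>m' = n + 1\<close> by simp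
    qed
  qed
  have "mono_on {1..N} ybar"
  proof (rule mono_onI)
    fix i k assume ik: "i \<in> {1..N}" "k \<in> {1..N}" "i \<le> k"
    from \<open>i \<le> k\<close> have "k \<le> N \<longrightarrow> ybar i \<le> ybar k"
    proof (induction k rule: dec_induct)
      case (step k)
      then show ?case using \<open>\<And>i. 1 \<le> i \<Longrightarrow> Suc i \<le> N \<Longrightarrow> ybar i \<le> ybar (Suc i)\<close>[of k] ik(1) by auto
    qed simp
    then show "ybar i \<le> ybar k" using ik by auto
  qed
  moreover have "ybar i = ybar m" "global_minimizer (block_cost f m n) (ybar i)"
    if "(m, n) \<in> J" "i \<in> {m..n}" for m n i
    using val[OF that(1), of i] val[OF that(1), of m] part that by auto
  ultimately show ?thesis using that[of J] part by blast
qed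

text \<open>
  First-order optimality of the minimizer on each block bounds the slope sums of the blocks, and each
  level class of \<open>ybar\<close> is a union of blocks. The slopes of \<open>f i\<close> are required only at minimizers of the
  blocks containing \<open>i\<close>, since a cost function may have infinite slopes elsewhere.
\<close>

lemma pav_zero_in_clarke_gradient:
  fixes pos :: "'n::finite \<Rightarrow> nat"
  assumes pos: "bij_betw pos UNIV {1..CARD('n)}" and pav: "pav_returns f CARD('n) ybar"
    and slopes: "\<And>m n i. 1 \<le> m \<Longrightarrow> i \<in> {m..n} \<Longrightarrow> n \<le> CARD('n) \<Longrightarrow>
      global_minimizer (block_cost f m n) (ybar i) \<Longrightarrow>
      one_sided_slopes (f i) (ybar i) (l i) (r i)"
    and smooth: "\<And>i. i \<in> {1..CARD('n)} \<Longrightarrow> ybar i \<noteq> B \<Longrightarrow> l i = r i"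
  shows "locally_lipschitz_at (sorted_cost f) (\<chi> j::'n. ybar (pos j)) \<and>
    0 \<in> clarke_gradient (sorted_cost f) (\<chi> j::'n. ybar (pos j))"
proof -
  obtain J where "finite J" and cover: "(\<Union>(m, n)\<in>J. {m..n}) = {1..CARD('n)}"
    and disj: "disjoint_family_on (\<lambda>(m, n). {m..n}) J"
    and minimizer: "\<And>m n i. (m, n) \<in> J \<Longrightarrow> i \<in> {m..n} \<Longrightarrow>
      global_minimizer (block_cost f m n) (ybar i)"
    and const: "\<And>m n i. (m, n) \<in> J \<Longrightarrow> i \<in> {m..n} \<Longrightarrow> ybar i = ybar m"
    and mono: "mono_on {1..CARD('n)} ybar"
    using pav_returns_blocks[OF pav] by blast
  have block_range: "1 \<le> m" "n \<le> CARD('n)" if "(m, n) \<in> J" "m \<le> n" for m n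
  proof -
    have "{m..n} \<subseteq> {1..CARD('n)}" using that(1) cover by blast
    then show "1 \<le> m" "n \<le> CARD('n)" using that(2) by auto
  qed
  have sl: "one_sided_slopes (f i) (ybar i) (l i) (r i)" if "(m, n) \<in> J" "i \<in> {m..n}" for m n i
    using slopes[of m i n] minimizer[OF that] block_range[OF that(1)] that by auto
  have sl': "one_sided_slopes (f i) (ybar i) (l i) (r i)" if "i \<in> {1..CARD('n)}" for i
    using that sl unfolding cover[symmetric] by blast
  have block_sign: "(\<Sum>i=m..n. l i) \<le> 0 \<and> 0 \<le> (\<Sum>i=m..n. r i)" if "(m, n) \<in> J" for m n
  proof (cases "m \<le> n")
    case True
    have "one_sided_slopes (\<lambda>x. \<Sum>i=m..n. f i x) (ybar m) (\<Sum>i=m..n. l i) (\<Sum>i=m..n. r i)"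
    proof (rule one_sided_slopes_sum)
      show "one_sided_slopes (f i) (ybar m) (l i) (r i)" if "i \<in> {m..n}" for i
        using sl[OF \<open>(m, n) \<in> J\<close> that] const[OF \<open>(m, n) \<in> J\<close> that] by metis
    qed simp
    then have "one_sided_slopes (block_cost f m n) (ybar m) (\<Sum>i=m..n. l i) (\<Sum>i=m..n. r i)"
      by (simp add: block_cost_def[abs_def])
    then show ?thesis
      using global_minimizer_slopes[OF _ minimizer[OF that, of m]] True by simp
  qed simp
  have level_sum: "(\<Sum>i | i \<in> {1..CARD('n)} \<and> ybar i = c. g i)
      = (\<Sum>(m, n)\<in>{A \<in> J. ybar (fst A) = c}. \<Sum>i=m..n. g i)" for g :: "nat \<Rightarrow> real" and c
  proof -
    have "{i \<in> {1..CARD('n)}. ybar i = c} = (\<Union>A\<in>{A \<in> J. ybar (fst A) = c}. {fst A..snd A})"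
    proof -
      have level: "ybar i = c \<longleftrightarrow> ybar (fst A) = c" if "A \<in> J" "i \<in> {fst A..snd A}" for A i
        using const[of "fst A" "snd A" i] that by simp
      have member: "i \<in> {1..CARD('n)} \<longleftrightarrow> (\<exists>A\<in>J. i \<in> {fst A..snd A})" for i
        using cover by (simp only: set_eq_iff UN_iff case_prod_unfold)
      show ?thesis
      proof (rule set_eqI)
        fix i
        show "i \<in> {i \<in> {1..CARD('n)}. ybar i = c} \<longleftrightarrow>
            i \<in> (\<Union>A\<in>{A \<in> J. ybar (fst A) = c}. {fst A..snd A})"
          unfolding mem_Collect_eq UN_iff member bex_simps using level by blast
      qed
    qed
    also have "sum g \<dots> = (\<Sum>A\<in>{A \<in> J. ybar (fst A) = c}. \<Sum>i\<in>{fst A..snd A}. g i)"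
    proof (rule sum.UNION_disjoint)
      show "\<forall>A\<in>{A \<in> J. ybar (fst A) = c}. \<forall>D\<in>{A \<in> J. ybar (fst A) = c}.
          A \<noteq> D \<longrightarrow> {fst A..snd A} \<inter> {fst D..snd D} = {}"
        using disj unfolding disjoint_family_on_def case_prod_unfold by blast
    qed (use \<open>finite J\<close> in auto)
    finally show ?thesis by (simp add: case_prod_unfold)
  qed
  have "(\<Sum>i | i \<in> {1..CARD('n)} \<and> ybar i = c. l i) \<le> 0" for c
    unfolding level_sum using block_sign by (intro sum_nonpos) auto
  moreover have "0 \<le> (\<Sum>i | i \<in> {1..CARD('n)} \<and> ybar i = c. r i)" for c
    unfolding level_sum using block_sign by (intro sum_nonneg) auto
  ultimately have "0 \<in> clarke_gradient (sorted_cost f) (\<chi> j::'n. ybar (pos j))"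
    using sl' smooth by (intro zero_in_clarke_gradient_sorted_cost[OF pos mono])
  moreover have "locally_lipschitz_at (sorted_cost f) (\<chi> j::'n. ybar (pos j))"
    using sl' by (intro sorted_cost_locally_lipschitz[OF pos mono] one_sided_slopes_imp_locally_lipschitz)
  ultimately show ?thesis by simp
qed

section \<open>Slopes of the weighted utility costs\<close>

text \<open>
  Stated for a filter, so that one proof serves \<open>U'\<close> at both sides of \<open>B\<close>: it increases towards \<open>B\<close>
  from either side.
\<close>

lemma eventually_monotone_limit:
  fixes h :: "real \<Rightarrow> real"
  assumes S: "eventually (\<lambda>x. x \<in> S) F" and "S \<noteq> {}"
    and mono: "\<And>x. x \<in> S \<Longrightarrow> eventually (\<lambda>y. h x \<le> h y) F"
    and not_top: "\<not> filterlim h at_top F"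
  shows "\<exists>l. (h \<longlongrightarrow> l) F"
proof -
  have "bdd_above (h ` S)"
  proof (rule ccontr)
    assume unbounded: "\<not> bdd_above (h ` S)"
    have "eventually (\<lambda>y. Z \<le> h y) F" for Z
    proof -
      obtain x where "x \<in> S" "Z < h x"
        using unbounded by (auto simp: bdd_above_def not_le)
      from mono[OF this(1)] show ?thesis
        using \<open>Z < h x\<close> by (auto elim: eventually_mono)
    qed
    then show False using not_top by (simp add: filterlim_at_top)
  qed
  have "(h \<longlongrightarrow> (SUP x\<in>S. h x)) F"
  proof (rule increasing_tendsto)
    show "eventually (\<lambda>y. h y \<le> (SUP x\<in>S. h x)) F"
      using S by eventually_elim (rule cSUP_upper[OF _ \<open>bdd_above (h ` S)\<close>])
    fix z assume "z < (SUP x\<in>S. h x)"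
    then obtain x where "x \<in> S" "z < h x"
      using less_cSUP_iff[OF \<open>S \<noteq> {}\<close> \<open>bdd_above (h ` S)\<close>] by auto
    from mono[OF this(1)] show "eventually (\<lambda>y. z < h y) F"
      using \<open>z < h x\<close> by (auto elim: eventually_mono)
  qed
  then show ?thesis by blast
qed

locale s_shaped_utility =
  fixes U :: "real \<Rightarrow> real" and B :: real
  assumes U_B: "U B = 0" and U_mono: "strict_mono U" and U_cont: "continuous_on UNIV U"
    and U_diff: "\<And>x. x \<noteq> B \<Longrightarrow> U differentiable (at x)"
    and U'_diff: "\<And>x. x \<noteq> B \<Longrightarrow> deriv U differentiable (at x)"
    and convex_left: "\<And>x. x < B \<Longrightarrow> deriv (deriv U) x > 0"
    and concave_right: "\<And>x. x > B \<Longrightarrow> deriv (deriv U) x < 0"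
    and infinite_slopes: "filterlim (deriv U) at_top (at_left B) \<longleftrightarrow> filterlim (deriv U) at_top (at_right B)"
begin

lemma deriv_U_has_derivative:
  "x \<noteq> B \<Longrightarrow> (deriv U has_real_derivative deriv (deriv U) x) (at x)"
  using U'_diff by (simp add: DERIV_deriv_iff_real_differentiable)

lemma finite_slopes:
  assumes "\<not> filterlim (deriv U) at_top (at_right B)"
  shows "\<exists>u. (deriv U \<longlongrightarrow> u) (at_left B)" and "\<exists>u. (deriv U \<longlongrightarrow> u) (at_right B)"
proof -
  show "\<exists>u. (deriv U \<longlongrightarrow> u) (at_left B)"
  proof (rule eventually_monotone_limit[where S = "{..<B}"])
    show "\<forall>\<^sub>F y in at_left B. deriv U x \<le> deriv U y" if "x \<in> {..<B}" for x
    proof (rule eventually_at_leftI)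
      fix y assume "y \<in> {x<..<B}"
      show "deriv U x \<le> deriv U y"
      proof (rule DERIV_nonneg_imp_nondecreasing[where f = "deriv U"])
        fix t assume "x \<le> t" "t \<le> y"
        then show "\<exists>d. (deriv U has_real_derivative d) (at t) \<and> 0 \<le> d"
          using \<open>y \<in> {x<..<B}\<close> deriv_U_has_derivative[of t] convex_left[of t]
          by (intro exI[of _ "deriv (deriv U) t"]) simp
      qed (use \<open>y \<in> {x<..<B}\<close> in simp)
    qed (use that in simp)
  qed (use assms infinite_slopes lt_ex[of B] in \<open>auto simp: eventually_at_filter\<close>)
  show "\<exists>u. (deriv U \<longlongrightarrow> u) (at_right B)"
  proof (rule eventually_monotone_limit[where S = "{B<..}"])
    show "\<forall>\<^sub>F y in at_right B. deriv U x \<le> deriv U y" if "x \<in> {B<..}" for x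
    proof (rule eventually_at_rightI)
      fix y assume "y \<in> {B<..<x}"
      show "deriv U x \<le> deriv U y"
      proof (rule DERIV_nonpos_imp_nonincreasing[where f = "deriv U"])
        fix t assume "y \<le> t" "t \<le> x"
        then show "\<exists>d. (deriv U has_real_derivative d) (at t) \<and> d \<le> 0"
          using \<open>y \<in> {B<..<x}\<close> deriv_U_has_derivative[of t] concave_right[of t]
          by (intro exI[of _ "deriv (deriv U) t"]) simp
      qed (use \<open>y \<in> {B<..<x}\<close> in simp)
    qed (use that in simp)
  qed (use assms gt_ex[of B] in \<open>auto simp: eventually_at_filter\<close>)
qed

definition cost_slope :: "real \<Rightarrow> (nat \<Rightarrow> real) \<Rightarrow> (nat \<Rightarrow> real) \<Rightarrow> (nat \<Rightarrow> real) \<Rightarrow> nat \<Rightarrow> real \<Rightarrow> real" where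
  "cost_slope \<sigma> w a b i x = - (weight B a b i x * deriv U x) + \<sigma> * (x - w i)"

text \<open>
  The weight jumps at \<open>B\<close>, but since \<open>U\<close> changes sign exactly there, the weighted utility is a
  combination of the negative and the positive part of \<open>U\<close>. This form shows the continuity of the cost.
\<close>

lemma cost_eq_min_max:
  "cost U B \<sigma> w a b i y = - (a i * min (U y) 0 + b i * max (U y) 0) + \<sigma> / 2 * (y - w i)\<^sup>2"
proof -
  have "U y \<le> 0 \<longleftrightarrow> y \<le> B"
    using strict_mono_less_eq[OF U_mono, of y B] by (simp add: U_B)
  then show ?thesis by (auto simp: cost_def weight_def min_def max_def)
qed

lemma isCont_cost: "isCont (cost U B \<sigma> w a b i) v"
proof -
  have "isCont U v" using U_cont by (simp add: continuous_on_eq_continuous_at)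
  then show ?thesis unfolding cost_eq_min_max[abs_def] by (intro continuous_intros)
qed

lemma eventually_weight:
  "v < B \<Longrightarrow> \<forall>\<^sub>F x in nhds v. weight B a b i x = a i"
  "v > B \<Longrightarrow> \<forall>\<^sub>F x in nhds v. weight B a b i x = b i"
  "\<forall>\<^sub>F x in at_left B. weight B a b i x = a i"
  "\<forall>\<^sub>F x in at_right B. weight B a b i x = b i"
proof -
  show "\<forall>\<^sub>F x in nhds v. weight B a b i x = a i" if "v < B"
  proof -
    have "\<forall>\<^sub>F x in nhds v. x \<in> {..<B}" using that by (intro eventually_nhds_in_open) auto
    then show ?thesis by eventually_elim (simp add: weight_def)
  qed
  show "\<forall>\<^sub>F x in nhds v. weight B a b i x = b i" if "v > B"
  proof -
    have "\<forall>\<^sub>F x in nhds v. x \<in> {B<..}" using that by (intro eventually_nhds_in_open) auto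
    then show ?thesis by eventually_elim (simp add: weight_def)
  qed
qed (auto simp: eventually_at_filter weight_def)

lemma eventually_nhds_weight:
  "v \<noteq> B \<Longrightarrow> \<forall>\<^sub>F x in nhds v. weight B a b i x = weight B a b i v"
  using eventually_weight(1,2)[of v a b i]
  by (cases v B rule: linorder_cases) (simp_all add: weight_def[of B a b i v])

lemma cost_has_derivative:
  assumes "x \<noteq> B"
  shows "(cost U B \<sigma> w a b i has_real_derivative cost_slope \<sigma> w a b i x) (at x)"
proof -
  have "(U has_real_derivative deriv U x) (at x)"
    using U_diff[OF assms] by (simp add: DERIV_deriv_iff_real_differentiable)
  then have "((\<lambda>y. - (weight B a b i x * U y) + \<sigma> / 2 * (y - w i)\<^sup>2) has_real_derivative
      cost_slope \<sigma> w a b i x) (at x)"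
    by (auto intro!: derivative_eq_intros simp: cost_slope_def)
  moreover have "\<forall>\<^sub>F y in nhds x. - (weight B a b i x * U y) + \<sigma> / 2 * (y - w i)\<^sup>2
      = cost U B \<sigma> w a b i y"
    using eventually_nhds_weight[OF assms, of a b i] by eventually_elim (simp add: cost_def)
  ultimately show ?thesis by (simp only: DERIV_cong_ev[OF refl _ refl])
qed

lemma eventually_cost_has_derivative:
  "\<forall>\<^sub>F x in at v. (cost U B \<sigma> w a b i has_real_derivative cost_slope \<sigma> w a b i x) (at x)"
  using eventually_neq_at_within[of B v UNIV] by eventually_elim (rule cost_has_derivative)

lemma cost_slopes_smooth:
  assumes "v \<noteq> B"
  shows "one_sided_slopes (cost U B \<sigma> w a b i) v (cost_slope \<sigma> w a b i v) (cost_slope \<sigma> w a b i v)"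
proof (rule one_sided_slopesI[OF isCont_cost eventually_cost_has_derivative])
  have "isCont (deriv U) v" using deriv_U_has_derivative[OF assms] by (rule DERIV_isCont)
  then have "((\<lambda>x. - (weight B a b i v * deriv U x) + \<sigma> * (x - w i)) \<longlongrightarrow> cost_slope \<sigma> w a b i v) (at v)"
    by (auto intro!: tendsto_eq_intros simp: cost_slope_def isCont_def)
  moreover have "\<forall>\<^sub>F x in at v. - (weight B a b i v * deriv U x) + \<sigma> * (x - w i) = cost_slope \<sigma> w a b i x"
    using eventually_nhds_weight[OF assms, of a b i] unfolding eventually_at_filter
    by eventually_elim (simp add: cost_slope_def)
  ultimately have "(cost_slope \<sigma> w a b i \<longlongrightarrow> cost_slope \<sigma> w a b i v) (at v)"
    by (rule Lim_transform_eventually)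
  then show "(cost_slope \<sigma> w a b i \<longlongrightarrow> cost_slope \<sigma> w a b i v) (at_left v)"
    "(cost_slope \<sigma> w a b i \<longlongrightarrow> cost_slope \<sigma> w a b i v) (at_right v)"
    by (simp_all add: filterlim_at_split)
qed

lemma cost_slopes_kink:
  assumes "(deriv U \<longlongrightarrow> ul) (at_left B)" "(deriv U \<longlongrightarrow> ur) (at_right B)"
  shows "one_sided_slopes (cost U B \<sigma> w a b i) B
    (- (a i * ul) + \<sigma> * (B - w i)) (- (b i * ur) + \<sigma> * (B - w i))"
proof (rule one_sided_slopesI[OF isCont_cost eventually_cost_has_derivative])
  have "((\<lambda>x. - (a i * deriv U x) + \<sigma> * (x - w i)) \<longlongrightarrow> - (a i * ul) + \<sigma> * (B - w i)) (at_left B)"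
    using assms(1) by (intro tendsto_intros)
  moreover have "\<forall>\<^sub>F x in at_left B. - (a i * deriv U x) + \<sigma> * (x - w i) = cost_slope \<sigma> w a b i x"
    using eventually_weight(3)[of a b i] by eventually_elim (simp add: cost_slope_def)
  ultimately show "(cost_slope \<sigma> w a b i \<longlongrightarrow> - (a i * ul) + \<sigma> * (B - w i)) (at_left B)"
    by (rule Lim_transform_eventually)
  have "((\<lambda>x. - (b i * deriv U x) + \<sigma> * (x - w i)) \<longlongrightarrow> - (b i * ur) + \<sigma> * (B - w i)) (at_right B)"
    using assms(2) by (intro tendsto_intros)
  moreover have "\<forall>\<^sub>F x in at_right B. - (b i * deriv U x) + \<sigma> * (x - w i) = cost_slope \<sigma> w a b i x"
    using eventually_weight(4)[of a b i] by eventually_elim (simp add: cost_slope_def)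
  ultimately show "(cost_slope \<sigma> w a b i \<longlongrightarrow> - (b i * ur) + \<sigma> * (B - w i)) (at_right B)"
    by (rule Lim_transform_eventually)
qed

text \<open>
  If \<open>U'\<close> is infinite to the right of \<open>B\<close>, the positive weights make all costs decrease there.
\<close>

lemma kink_not_minimizer:
  assumes inf: "filterlim (deriv U) at_top (at_right B)" and "m \<le> n"
    and b: "\<And>i. i \<in> {m..n} \<Longrightarrow> b i > 0"
  shows "\<not> global_minimizer (block_cost (cost U B \<sigma> w a b) m n) B"
proof
  let ?f = "cost U B \<sigma> w a b"
  assume min: "global_minimizer (block_cost ?f m n) B"
  have "\<forall>\<^sub>F x in at_right B. cost_slope \<sigma> w a b i x < 0" if "i \<in> {m..n}" for i
  proof -
    have "((\<lambda>x. - \<sigma> * (x - w i)) \<longlongrightarrow> - \<sigma> * (B - w i)) (at_right B)"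
      by (intro tendsto_intros)
    moreover have "filterlim (\<lambda>x. b i * deriv U x) at_top (at_right B)"
      using b[OF that] by (intro filterlim_tendsto_pos_mult_at_top[OF tendsto_const _ inf])
    ultimately have "filterlim (\<lambda>x. - \<sigma> * (x - w i) + b i * deriv U x) at_top (at_right B)"
      by (rule filterlim_tendsto_add_at_top)
    then have "\<forall>\<^sub>F x in at_right B. 0 < - \<sigma> * (x - w i) + b i * deriv U x"
      unfolding filterlim_at_top_dense by blast
    with eventually_weight(4)[of a b i] show ?thesis
      by eventually_elim (simp add: cost_slope_def)
  qed
  then have "\<forall>\<^sub>F x in at_right B. \<forall>i\<in>{m..n}. cost_slope \<sigma> w a b i x < 0"
    by (intro eventually_ball_finite) auto
  then have "\<forall>\<^sub>F x in at_right B. (\<Sum>i=m..n. cost_slope \<sigma> w a b i x) < 0"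
  proof eventually_elim
    case (elim x)
    have "(\<Sum>i=m..n. cost_slope \<sigma> w a b i x) < (\<Sum>i=m..n. 0)"
      using elim \<open>m \<le> n\<close> by (intro sum_strict_mono) auto
    then show ?case by simp
  qed
  moreover have "\<not> (\<forall>\<^sub>F x in at_right B. (\<Sum>i=m..n. cost_slope \<sigma> w a b i x) < 0)"
  proof (rule minimizer_not_decreasing_right[OF _ _ min])
    show "isCont (block_cost ?f m n) B"
      unfolding block_cost_def[abs_def] by (intro continuous_intros isCont_cost)
    show "\<forall>\<^sub>F x in at_right B. (block_cost ?f m n has_real_derivative
        (\<Sum>i=m..n. cost_slope \<sigma> w a b i x)) (at x)"
      using eventually_neq_at_within[of B B "{B<..}"] unfolding block_cost_def[abs_def]
      by eventually_elim (intro DERIV_sum cost_has_derivative)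
  qed
  ultimately show False by contradiction
qed

end

theorem theorem3:
  fixes U :: "real \<Rightarrow> real" and B \<sigma> :: real
    and w a b ybar :: "nat \<Rightarrow> real"
    and pos :: "'n::finite \<Rightarrow> nat"
  assumes "U B = 0"
    and "strict_mono U" and "continuous_on UNIV U"
    and "Ck_on 3 U {..<B}" and "Ck_on 3 U {B<..}"
    and "\<forall>x<B. (deriv ^^ 2) U x > 0" and "\<forall>x>B. (deriv ^^ 2) U x < 0"
    and "\<forall>x<B. (deriv ^^ 3) U x > 0"
    and "filterlim (deriv U) at_top (at_left B) \<longleftrightarrow> filterlim (deriv U) at_top (at_right B)"
    and "\<sigma> > 0"
    and "mono_on {1..CARD('n)} w"
    and "\<forall>i\<in>{1..CARD('n)}. a i > 0 \<and> b i > 0"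
    and "bij_betw pos UNIV {1..CARD('n)}"
    and "pav_returns (cost U B \<sigma> w a b) CARD('n) ybar"
  shows "locally_lipschitz_at (sorted_cost (cost U B \<sigma> w a b)) (\<chi> j::'n. ybar (pos j)) \<and>
    0 \<in> clarke_gradient (sorted_cost (cost U B \<sigma> w a b)) (\<chi> j::'n. ybar (pos j))"
proof -
  have smooth: "(deriv ^^ j) U differentiable (at x)" if "x \<noteq> B" "j < 3" for j x
    using assms(4,5) that by (cases x B rule: linorder_cases) (auto simp: Ck_on_def)
  interpret s_shaped_utility U B
  proof
    have "(deriv ^^ 2) U = deriv (deriv U)" by (simp add: numeral_2_eq_2)
    then show "x < B \<Longrightarrow> deriv (deriv U) x > 0" "x > B \<Longrightarrow> deriv (deriv U) x < 0" for x
      using assms(6,7) by simp_all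
    show "x \<noteq> B \<Longrightarrow> U differentiable (at x)" "x \<noteq> B \<Longrightarrow> deriv U differentiable (at x)" for x
      using smooth[of x 0] smooth[of x 1] by simp_all
  qed (fact assms)+
  \<comment> \<open>These limits need not exist in general, but they do when some block value is \<open>B\<close>, and only
    then do \<open>l\<close> and \<open>r\<close> refer to them.\<close>
  define ul where "ul = Lim (at_left B) (deriv U)"
  define ur where "ur = Lim (at_right B) (deriv U)"
  define l where "l i = (if ybar i = B then - (a i * ul) + \<sigma> * (B - w i)
    else cost_slope \<sigma> w a b i (ybar i))" for i
  define r where "r i = (if ybar i = B then - (b i * ur) + \<sigma> * (B - w i)
    else cost_slope \<sigma> w a b i (ybar i))" for i
  show ?thesis
  proof (rule pav_zero_in_clarke_gradient[OF assms(13,14), where l = l and r = r and B = B])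
    fix m n i
    assume range: "1 \<le> m" "i \<in> {m..n}" "n \<le> CARD('n)"
      and min: "global_minimizer (block_cost (cost U B \<sigma> w a b) m n) (ybar i)"
    show "one_sided_slopes (cost U B \<sigma> w a b i) (ybar i) (l i) (r i)"
    proof (cases "ybar i = B")
      case True
      have "\<not> filterlim (deriv U) at_top (at_right B)"
        using kink_not_minimizer[of m n b \<sigma> w a] min True range assms(12) by auto
      then obtain u v where "(deriv U \<longlongrightarrow> u) (at_left B)" "(deriv U \<longlongrightarrow> v) (at_right B)"
        using finite_slopes by blast
      then have "(deriv U \<longlongrightarrow> ul) (at_left B)" "(deriv U \<longlongrightarrow> ur) (at_right B)"
        by (simp_all add: ul_def ur_def tendsto_Lim)
      from cost_slopes_kink[OF this] show ?thesis by (simp add: True l_def r_def)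
    next
      case False
      from cost_slopes_smooth[OF this] show ?thesis by (simp add: False l_def r_def)
    qed
  qed (simp add: l_def r_def)
qed

end
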